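(* Let $\kappa$ be a cardinal with $2<\kappa<\mathfrak c$ and $2^\kappa\le\mathfrak c$. Then there exists a partition $\{B_\xi:\xi<\kappa\}$ of $\mathbb R$ such that (1) every $B_\xi$ is a Bernstein set, (2) no $B_\xi$ is a $2$-covering, and (3) $\{B_\xi:\xi<\kappa\}$ is a $\kappa$-S-covering.
   Context: $\mathfrak c=|\mathbb R|$. A set $B\subseteq\mathbb R$ is a Bernstein set if for every uncountable Borel $Z\subseteq\mathbb R$ both $Z\cap B$ and $Z\setminus B$ are nonempty. A set $A$ is a $2$-covering if every $C\subseteq\mathbb R$ with $|C|=2$ has a translate $C+x\subseteq A$. A family $\mathcal A$ of pairwise disjoint subsets of $\mathbb R$ is a $\kappa$-S-covering if $|\mathcal A|=\kappa$ and for every $F\subseteq\mathbb R$ with $|F|=\kappa$ there is $t\in\mathbb R$ such that $F+t\subseteq\bigcup\mathcal A$ and $|(F+t)\cap A|=1$ for every $A\in\mathcal A$. *)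

theory Defs
  imports "HOL-Analysis.Analysis" "HOL-Library.Equipollence"
begin

definition bernstein :: "real set \<Rightarrow> bool" where
  "bernstein B \<longleftrightarrow>
     (\<forall>Z. Z \<in> sets borel \<and> uncountable Z \<longrightarrow> Z \<inter> B \<noteq> {} \<and> Z - B \<noteq> {})"

definition two_covering :: "real set \<Rightarrow> bool" where
  "two_covering A \<longleftrightarrow> (\<forall>C::real set. card C = 2 \<longrightarrow> (\<exists>x. (\<lambda>c. c + x) ` C \<subseteq> A))"

text \<open>kappa-S-covering, where the cardinal kappa is represented by a set K of cardinality kappa.\<close>
definition S_covering :: "'a set \<Rightarrow> real set set \<Rightarrow> bool" where
  "S_covering K \<A> \<longleftrightarrow>
     (\<forall>A\<in>\<A>. \<forall>A'\<in>\<A>. A \<noteq> A' \<longrightarrow> A \<inter> A' = {}) \<and> \<A> \<approx> K \<and>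
     (\<forall>F::real set. F \<approx> K \<longrightarrow>
        (\<exists>t. (\<lambda>f. f + t) ` F \<subseteq> \<Union>\<A> \<and> (\<forall>A\<in>\<A>. card ((\<lambda>f. f + t) ` F \<inter> A) = 1)))"

end

theory Submission
  imports Defs
begin

text \<open>
  Colour the reals with \<open>K\<close> so that \<open>x\<close> and \<open>x + 1\<close> always get different colours; then no colour class
  contains a translate of \<open>{0, 1}\<close>. There are at most continuum many tasks: ``the Borel set \<open>Z\<close> gets
  a point of colour \<open>\<xi>\<close>'' and ``some translate of \<open>F\<close> is coloured bijectively''. Each of them is
  settled by colouring a set of size at most \<open>K\<close>, and by transfinite recursion of length continuum these
  sets can be chosen so that points of different ones are neither equal nor at distance 1. As there are
  at least three colours and every point has only two neighbours at distance 1, the partial colouring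
  extends greedily to all of the reals.

  The recursion needs that an uncountable Borel set has the size of the continuum. Every Borel set
  is the injective continuous image of a closed set of real sequences, which reduces this to the case of
  closed subsets of a Polish space, where the condensation points form a perfect set.
\<close>

section \<open>Cardinal arithmetic\<close>

lemma lepoll_iff_ordLeq: "A \<lesssim> B \<longleftrightarrow> (card_of A, card_of B) \<in> ordLeq"
  unfolding lepoll_def by (simp add: card_of_ordLeq)

lemma lepoll_total: "A \<lesssim> B \<or> B \<lesssim> A"
  using ordLeq_total[OF card_of_Well_order card_of_Well_order] by (simp add: lepoll_iff_ordLeq)

lemma infinite_square_eqpoll: "infinite A \<Longrightarrow> A \<times> A \<approx> A"
  by (simp add: eqpoll_iff_card_of_ordIso card_of_Times_same_infinite)

text \<open>By comparability of cardinals, one factor \<open>X\<close> dominates the other. If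
  \<open>X\<close> is infinite, the product embeds in \<open>X \<times> X\<close>, hence in
  \<open>X\<close>. No regularity of \<open>C\<close> enters.\<close>

lemma lesspoll_Times:
  assumes C: "infinite C" and A: "A \<prec> C" and B: "B \<prec> C"
  shows "A \<times> B \<prec> C"
proof -
  have *: "X \<times> Y \<prec> C" if "Y \<lesssim> X" "X \<prec> C" for X :: "'d set" and Y :: "'e set"
  proof (cases "finite X")
    case True
    then have "finite (X \<times> Y)"
      using that finite_lepoll_infinite[of X Y] lepoll_trans
      by (metis finite_SigmaI infinite_le_lepoll)
    then show ?thesis
      using C finite_lesspoll_infinite by blast
  next
    case False
    have "X \<times> Y \<lesssim> X \<times> X"
      using that by (intro times_lepoll_mono) auto
    with infinite_square_eqpoll[OF False] that show ?thesis
      by (meson eqpoll_imp_lepoll lesspoll_trans1)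
  qed
  show ?thesis
    using lepoll_total[of A B] *[of B A] *[of A B] A B times_commute_eqpoll eq_lesspoll_trans
    by blast
qed

text \<open>A well-order of least possible type has only proper initial segments of smaller
  cardinality. In a recursion over the reals, fewer than continuum many steps then precede any given
  one.\<close>

lemma ex_wf_small_segments:
  obtains R :: "('a \<times> 'a) set"
  where "wf R" "\<And>x y. x \<noteq> y \<Longrightarrow> (x, y) \<in> R \<or> (y, x) \<in> R"
    "\<And>x. {y. (y, x) \<in> R} \<prec> (UNIV :: 'a set)"
proof
  let ?r = "card_of (UNIV :: 'a set)"
  have w: "well_order_on UNIV ?r"
    by (rule card_of_well_order_on)
  then show "wf (?r - Id)"
    by (simp add: well_order_on_def)
  show "(x, y) \<in> ?r - Id \<or> (y, x) \<in> ?r - Id" if "x \<noteq> y" for x y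
    using w that by (auto simp: well_order_on_def linear_order_on_def total_on_def)
  show "{y. (y, x) \<in> ?r - Id} \<prec> (UNIV :: 'a set)" for x
  proof -
    have "{y. (y, x) \<in> ?r - Id} = underS ?r x"
      by (auto simp: underS_def)
    moreover have "(card_of (underS ?r x), ?r) \<in> ordLess"
      using card_of_underS[OF card_of_Card_order, of x] by (simp add: Field_card_of)
    ultimately show ?thesis
      unfolding lesspoll_def lepoll_iff_ordLeq eqpoll_iff_card_of_ordIso
      by (metis not_ordLess_ordIso ordLess_imp_ordLeq)
  qed
qed

text \<open>Coding reals by sets of naturals, a family of reals indexed by \<open>K\<close> becomes
  a subset of \<open>K \<times> ?N\<close>. This product is countable or of size at most
  \<open>K\<close>, so it has at most continuum many subsets.\<close>

lemma image_size_subsets_lepoll_reals: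
  fixes K :: "'a set"
  assumes "Pow K \<lesssim> (UNIV :: real set)"
  shows "{F :: real set. F \<approx> K} \<lesssim> (UNIV :: real set)"
proof -
  let ?N = "UNIV :: nat set"
  obtain h :: "nat set \<Rightarrow> real" where h: "bij h"
    using nat_sets_eqpoll_reals by (auto simp: eqpoll_def)
  have "{F :: real set. F \<approx> K} \<lesssim> Pow (K \<times> ?N)"
  proof (rule subset_image_lepoll, safe)
    fix F :: "real set"
    assume "F \<approx> K"
    then obtain g where g: "bij_betw g K F"
      using eqpoll_sym eqpoll_def by blast
    define S where "S = {(k, n). k \<in> K \<and> n \<in> inv h (g k)}"
    have "{n. (k, n) \<in> S} = inv h (g k)" if "k \<in> K" for k
      using that by (auto simp: S_def)
    then have "F = (\<lambda>k. h {n. (k, n) \<in> S}) ` K"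
      using g h by (auto simp: bij_betw_def bij_is_surj surj_f_inv_f)
    then show "F \<in> (\<lambda>S. (\<lambda>k. h {n. (k, n) \<in> S}) ` K) ` Pow (K \<times> ?N)"
      by (rule image_eqI) (auto simp: S_def)
  qed
  also have "Pow (K \<times> ?N) \<lesssim> (UNIV :: real set)"
  proof -
    have Pow_mono: "Pow A \<lesssim> Pow B" if "A \<lesssim> B" for A :: "'c set" and B :: "'d set"
      using that unfolding lepoll_def
      by (metis image_Pow_mono inj_on_image_Pow)
    show ?thesis
    proof (cases "finite K")
      case True
      then have "countable (K \<times> ?N)"
        by (simp add: countable_finite)
      then have "K \<times> ?N \<lesssim> ?N"
        by (auto simp: countable_def lepoll_def)
      from Pow_mono[OF this] nat_sets_eqpoll_reals show ?thesis
        by (simp add: lepoll_trans2)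
    next
      case False
      then have "K \<times> ?N \<lesssim> K \<times> K"
        by (intro times_lepoll_mono) (auto simp: infinite_le_lepoll)
      then have "K \<times> ?N \<lesssim> K"
        using infinite_square_eqpoll[OF False] by (rule lepoll_trans2)
      from Pow_mono[OF this] assms show ?thesis
        by (rule lepoll_trans)
    qed
  qed
  finally show ?thesis .
qed

section \<open>Uncountable Borel sets\<close>

lemma uncountable_closed_lepoll_reals:
  fixes C :: "'a :: polish_space set"
  assumes "closed C" "uncountable C"
  shows "(UNIV :: real set) \<lesssim> C"
proof -
  obtain \<B> :: "'a set set" where \<B>: "countable \<B>" "topological_basis \<B>"
    using ex_countable_basis by blast
  \<comment> \<open>\<open>N\<close> is the largest open set meeting \<open>C\<close> in a countable
    set: by the countable basis it is enough to unite countably many sets. The points of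
    \<open>C\<close> outside \<open>N\<close> are the condensation points.\<close>
  define N where "N = \<Union>{U \<in> \<B>. countable (U \<inter> C)}"
  have "countable (\<Union>U \<in> {U \<in> \<B>. countable (U \<inter> C)}. U \<inter> C)"
    using \<B>(1) by (intro countable_UN) auto
  then have cN: "countable (N \<inter> C)"
    by (rule countable_subset[rotated]) (auto simp: N_def)
  have big: "uncountable (U \<inter> C)" if U: "open U" "x \<in> U" and x: "x \<notin> N" for U x
  proof -
    obtain V where V: "V \<in> \<B>" "x \<in> V" "V \<subseteq> U"
      using topological_basisE[OF \<B>(2) U] by metis
    then have "uncountable (V \<inter> C)"
      using x by (auto simp: N_def)
    then show ?thesis
      using V(3) by (metis countable_subset inf_mono order_refl)
  qed
  have opN: "open N"
    using \<B>(2) by (auto simp: N_def intro: topological_basis_open)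
  define S where "S = C - N"
  have "closed S"
    using assms opN by (simp add: S_def closed_Diff)
  moreover have "\<exists>y. y \<noteq> x \<and> y \<in> S \<and> y \<in> T" if "x \<in> S" "x \<in> T" "open T" for x T
  proof -
    have "uncountable (T \<inter> C)"
      using big that by (auto simp: S_def)
    then have "uncountable (T \<inter> C - (N \<inter> C \<union> {x}))"
      using cN by (intro uncountable_minus_countable) auto
    then have "T \<inter> C - (N \<inter> C \<union> {x}) \<noteq> {}"
      by (metis countable_empty)
    then show ?thesis
      by (auto simp: S_def)
  qed
  ultimately have "euclidean derived_set_of S = S"
    by (auto simp: in_derived_set_of derived_set_of_def closed_def)
  moreover have "S \<noteq> {}"
    using assms cN by (metis Diff_eq_empty_iff S_def inf.absorb2)
  moreover have "completely_metrizable_space (euclidean :: 'a topology)"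
    by (metis Met_TC.completely_metrizable_space_mtopology complete_UNIV mcomplete_iff_complete
        mtopology_is_euclidean)
  ultimately have "(UNIV :: real set) \<lesssim> S"
    using lepoll_perfect_set by blast
  then show ?thesis
    by (rule lepoll_trans) (auto simp: S_def intro: subset_imp_lepoll)
qed

lemma closed_sets_lepoll_reals:
  "{C :: 'a :: second_countable_topology set. closed C} \<lesssim> (UNIV :: real set)"
proof -
  obtain \<B> :: "'a set set" where \<B>: "countable \<B>" "topological_basis \<B>"
    using ex_countable_basis by blast
  have "{C :: 'a set. closed C} \<lesssim> Pow \<B>"
  proof (rule subset_image_lepoll, safe)
    fix C :: "'a set"
    assume "closed C"
    then have "open (- C)"
      by (simp add: open_Compl)
    then obtain \<U> where "\<U> \<subseteq> \<B>" "\<Union>\<U> = - C"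
      using \<B>(2) by (auto simp: topological_basis_def)
    then show "C \<in> (\<lambda>\<U>. - \<Union>\<U>) ` Pow \<B>"
      by (metis PowI double_compl rev_image_eqI)
  qed
  also have "Pow \<B> \<lesssim> (UNIV :: nat set set)"
  proof -
    obtain f :: "'a set \<Rightarrow> nat" where "inj_on f \<B>"
      using \<B>(1) by (auto simp: countable_def)
    then show ?thesis
      unfolding lepoll_def using inj_on_image_Pow by blast
  qed
  also note nat_sets_eqpoll_reals
  finally show ?thesis .
qed

text \<open>Coordinate 0 holds a point of \<open>A\<close> and the remaining coordinates a unique
  certificate of its membership. Infinitely many coordinates leave room for countably many
  certificates at once.\<close>

definition injective_projection :: "real set \<Rightarrow> bool" where
  "injective_projection A \<longleftrightarrow> (\<exists>C :: (nat \<Rightarrow> real) set. closed C \<and> bij_betw (\<lambda>x. x 0) C A)"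

text \<open>A point of the intersection has one certificate for each \<open>n\<close>. Pairing
  interleaves them all in one sequence sharing coordinate 0, and \<open>s n\<close> reads off the
  one for \<open>A n\<close>.\<close>

lemma injective_projection_INT:
  assumes "\<And>n::nat. injective_projection (A n)"
  shows "injective_projection (\<Inter>n. A n)"
proof -
  obtain C :: "nat \<Rightarrow> (nat \<Rightarrow> real) set" where C: "\<And>n. closed (C n)" "\<And>n. bij_betw (\<lambda>x. x 0) (C n) (A n)"
    using assms unfolding injective_projection_def by metis
  define s where "s n x = (\<lambda>k. if k = 0 then x 0 else x (Suc (prod_encode (n, k))))"
    for n and x :: "nat \<Rightarrow> real"
  \<comment> \<open>The unused coordinates \<open>x (Suc (prod_encode (n, 0)))\<close> are set to 0 to keep the projection injective.\<close>
  define D where "D = (\<Inter>n. s n -` C n) \<inter> (\<Inter>n. {x. x (Suc (prod_encode (n, 0))) = 0})"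
  have "continuous_on UNIV (s n)" for n
  proof (rule continuous_on_coordinatewise_then_product)
    show "continuous_on UNIV (\<lambda>x. s n x k)" for k
      by (cases "k = 0") (simp_all add: s_def)
  qed
  then have "closed D"
    unfolding D_def
    by (intro closed_Int closed_INT ballI closed_vimage C closed_Collect_eq) simp_all
  moreover have "bij_betw (\<lambda>x. x 0) D (\<Inter>n. A n)"
  proof (intro bij_betw_imageI inj_onI equalityI subsetI)
    fix x y
    assume xy: "x \<in> D" "y \<in> D" "x 0 = y 0"
    have eq: "s n x = s n y" for n
      using xy C(2)[of n] by (intro inj_onD[of "\<lambda>x. x 0" "C n"]) (auto simp: D_def s_def bij_betw_def)
    then have "x (Suc (prod_encode (n, k))) = y (Suc (prod_encode (n, k)))" for n k
    proof (cases "k = 0")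
      case True
      then show ?thesis
        using xy by (simp add: D_def)
    next
      case False
      have "s n x k = s n y k"
        by (simp add: eq)
      with False show ?thesis
        by (simp add: s_def)
    qed
    then have "x (Suc m) = y (Suc m)" for m
      by (metis prod_decode_inverse surj_pair)
    with xy(3) show "x = y"
      by (intro ext) (metis not0_implies_Suc)
  next
    fix a
    assume "a \<in> (\<lambda>x. x 0) ` D"
    then obtain x where x: "x \<in> D" "a = x 0"
      by auto
    have "s n x 0 \<in> A n" for n
      using x C(2)[of n] by (auto simp: D_def bij_betw_def)
    then show "a \<in> (\<Inter>n. A n)"
      using x by (simp add: s_def)
  next
    fix a
    assume "a \<in> (\<Inter>n. A n)"
    then have "a \<in> (\<lambda>x. x 0) ` C n" for n
      using bij_betw_imp_surj_on[OF C(2)[of n]] by blast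
    then have "\<exists>x \<in> C n. x 0 = a" for n
      by (fastforce simp: image_iff)
    then obtain x where x: "\<And>n. x n \<in> C n" "\<And>n. x n 0 = a"
      by metis
    define y where "y = (\<lambda>m. case m of 0 \<Rightarrow> a | Suc m \<Rightarrow>
      (case prod_decode m of (n, k) \<Rightarrow> if k = 0 then 0 else x n k))"
    have "s n y = x n" for n
      using x(2) by (auto simp: s_def y_def fun_eq_iff)
    then have "y \<in> D" "y 0 = a"
      using x by (auto simp: D_def y_def)
    then show "a \<in> (\<lambda>x. x 0) ` D"
      by blast
  qed
  ultimately show ?thesis
    unfolding injective_projection_def by blast
qed

text \<open>By disjointness the point determines the index of its piece, so storing this index in
  the certificate keeps it unique. The map \<open>s\<close> deletes the stored index.\<close>

lemma injective_projection_disjoint_UN: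
  assumes "\<And>n::nat. injective_projection (A n)" and disj: "disjoint_family A"
  shows "injective_projection (\<Union>n. A n)"
proof -
  obtain C :: "nat \<Rightarrow> (nat \<Rightarrow> real) set" where C: "\<And>n. closed (C n)" "\<And>n. bij_betw (\<lambda>x. x 0) (C n) (A n)"
    using assms unfolding injective_projection_def by metis
  define s where "s x = (\<lambda>k. if k = 0 then x 0 else x (Suc k))" for x :: "nat \<Rightarrow> real"
  \<comment> \<open>The coordinate \<open>x 1\<close> names the piece containing \<open>x 0\<close>; written as an intersection, the set of such
    sequences is visibly closed.\<close>
  define D where "D = {x. x 1 \<in> \<nat>} \<inter> (\<Inter>n. {x. 1 \<le> \<bar>x 1 - real n\<bar>} \<union> s -` C n)"
  have "closed {x :: nat \<Rightarrow> real. x 1 \<in> \<nat>}"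
    using closed_vimage[of \<nat> "\<lambda>x :: nat \<Rightarrow> real. x 1"]
    by (simp add: vimage_def continuous_on_product_coordinates)
  moreover have "continuous_on UNIV s"
  proof (rule continuous_on_coordinatewise_then_product)
    show "continuous_on UNIV (\<lambda>x. s x k)" for k
      by (cases "k = 0") (simp_all add: s_def)
  qed
  ultimately have "closed D"
    unfolding D_def
    by (intro closed_Int closed_Un closed_INT ballI closed_vimage C closed_Collect_le)
      (simp_all add: continuous_on_rabs continuous_on_diff)
  have D_iff: "x \<in> D \<longleftrightarrow> (\<exists>n. x 1 = real n \<and> s x \<in> C n)" for x
  proof
    assume "x \<in> D"
    then obtain n where "x 1 = real n"
      by (auto simp: D_def elim: Nats_cases)
    with \<open>x \<in> D\<close> have "s x \<in> C n"
      unfolding D_def by (auto dest!: spec[of _ n])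
    with \<open>x 1 = real n\<close> show "\<exists>n. x 1 = real n \<and> s x \<in> C n"
      by blast
  next
    assume "\<exists>n. x 1 = real n \<and> s x \<in> C n"
    then obtain n where n: "x 1 = real n" "s x \<in> C n"
      by blast
    have "1 \<le> \<bar>real n - real m\<bar>" if "m \<noteq> n" for m
      using that by linarith
    with n show "x \<in> D"
      by (auto simp: D_def) metis
  qed
  have mem: "x 0 \<in> A n" if "s x \<in> C n" for x n
  proof -
    have "s x 0 \<in> A n"
      using that C(2)[of n] by (auto simp: bij_betw_def)
    then show ?thesis
      by (simp add: s_def)
  qed
  have "bij_betw (\<lambda>x. x 0) D (\<Union>n. A n)"
  proof (intro bij_betw_imageI inj_onI equalityI subsetI)
    fix x y
    assume xy: "x \<in> D" "y \<in> D" "x 0 = y 0"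
    then obtain m n where mn: "x 1 = real m" "s x \<in> C m" "y 1 = real n" "s y \<in> C n"
      by (auto simp: D_iff)
    then have "x 0 \<in> A m \<inter> A n"
      using mem xy(3) by force
    then have [simp]: "m = n"
      using disj by (auto simp: disjoint_family_on_def)
    have eq: "s x = s y"
      using xy mn C(2)[of n] by (intro inj_onD[of "\<lambda>x. x 0" "C n"]) (auto simp: s_def bij_betw_def)
    then have "x (Suc k) = y (Suc k)" for k
    proof (cases "k = 0")
      case True
      then show ?thesis
        using mn by simp
    next
      case False
      have "s x k = s y k"
        by (simp add: eq)
      with False show ?thesis
        by (simp add: s_def)
    qed
    with xy(3) show "x = y"
      by (intro ext) (metis not0_implies_Suc)
  next
    fix a
    assume "a \<in> (\<lambda>x. x 0) ` D"
    then obtain x n where "a = x 0" "s x \<in> C n"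
      by (auto simp: D_iff)
    with mem show "a \<in> (\<Union>n. A n)"
      by blast
  next
    fix a
    assume "a \<in> (\<Union>n. A n)"
    then obtain n where "a \<in> (\<lambda>x. x 0) ` C n"
      using bij_betw_imp_surj_on[OF C(2)] by blast
    then obtain x where x: "x \<in> C n" "x 0 = a"
      by blast
    define y where "y = (\<lambda>m. if m = 0 then a else if m = 1 then real n else x (m - 1))"
    have "s y = x" "y 1 = real n" "y 0 = a"
      using x(2) by (auto simp: s_def y_def fun_eq_iff)
    with x(1) have "y \<in> D" "y 0 = a"
      by (auto simp: D_iff)
    then show "a \<in> (\<lambda>x. x 0) ` D"
      by blast
  qed
  with \<open>closed D\<close> show ?thesis
    unfolding injective_projection_def by blast
qed

lemma injective_projection_closed:
  assumes "closed A"
  shows "injective_projection A"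
proof -
  define D where "D = (\<lambda>x :: nat \<Rightarrow> real. x 0) -` A \<inter> (\<Inter>n. {x. x (Suc n) = 0})"
  have "closed D"
    unfolding D_def
    by (intro closed_Int closed_INT ballI closed_vimage assms closed_Collect_eq)
      (auto intro!: continuous_intros continuous_on_product_coordinates)
  moreover have "bij_betw (\<lambda>x. x 0) D A"
  proof (rule bij_betw_byWitness[where f' = "\<lambda>a k. if k = 0 then a else 0"])
    show "\<forall>x\<in>D. (\<lambda>k. if k = 0 then x 0 else 0) = x"
      by (auto simp: D_def fun_eq_iff gr0_conv_Suc)
  qed (auto simp: D_def)
  ultimately show ?thesis
    unfolding injective_projection_def by blast
qed

text \<open>The reciprocal of \<open>x 0 - a\<close> as certificate turns the open condition into a
  closed one: a branch of a hyperbola, selected by \<open>0 \<le> x 1\<close>.\<close>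

lemma injective_projection_greaterThan: "injective_projection {a<..}"
proof -
  define D where "D = {x :: nat \<Rightarrow> real. 0 \<le> x 1} \<inter> {x. x 1 * (x 0 - a) = 1}
    \<inter> (\<Inter>n. {x. x (Suc (Suc n)) = 0})"
  have "closed D"
    unfolding D_def
    by (intro closed_Int closed_INT ballI closed_Collect_eq closed_Collect_le)
      (auto intro!: continuous_intros continuous_on_product_coordinates)
  moreover have "bij_betw (\<lambda>x. x 0) D {a<..}"
  proof (rule bij_betw_byWitness[where f' = "\<lambda>b k. if k = 0 then b else if k = 1 then 1 / (b - a) else 0"])
    have "1 / (x 0 - a) = x 1" if "x \<in> D" for x
      using that by (auto simp: D_def divide_simps)
    moreover have "x k = 0" if "x \<in> D" and k: "k \<noteq> 0" "k \<noteq> 1" for x k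
    proof -
      obtain m where "k = Suc (Suc m)"
        using k by (metis One_nat_def not0_implies_Suc)
      then show ?thesis
        using that by (auto simp: D_def)
    qed
    ultimately show "\<forall>x\<in>D. (\<lambda>k. if k = 0 then x 0 else if k = 1 then 1 / (x 0 - a) else 0) = x"
      by (auto simp: fun_eq_iff)
    show "(\<lambda>x. x 0) ` D \<subseteq> {a<..}"
      by (auto simp: D_def) (smt (verit) mult_nonneg_nonpos)
  qed (auto simp: D_def)
  ultimately show ?thesis
    unfolding injective_projection_def by blast
qed

text \<open>Carrying the complement along makes the complement case trivial. The induction forms
  disjoint unions only, as injectivity requires, and the complement of a union is an intersection,
  for which disjointness is not at issue.\<close>

lemma injective_projection_borel:
  assumes "A \<in> sets borel"
  shows "injective_projection A"
proof -
  have *: "Int_stable (range (\<lambda>a :: real. {..a}))" "range (\<lambda>a :: real. {..a}) \<subseteq> Pow UNIV"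
    by (auto simp: Int_stable_def)
  have "A \<in> sigma_sets UNIV (range (\<lambda>a :: real. {..a}))"
    using assms by (simp add: borel_eq_atMost)
  with * have "injective_projection A \<and> injective_projection (- A)"
  proof (induction rule: sigma_sets_induct_disjoint)
    case (basic A)
    then show ?case
      by (auto simp: Compl_atMost intro: injective_projection_closed injective_projection_greaterThan)
  next
    case (union A)
    then show ?case
      using injective_projection_disjoint_UN[of A] injective_projection_INT[of "\<lambda>n. - A n"]
      by (simp add: Compl_UN)
  qed (auto simp: Compl_eq_Diff_UNIV[symmetric] intro: injective_projection_closed)
  then show ?thesis ..
qed

lemma uncountable_borel_lepoll_reals:
  fixes A :: "real set"
  assumes "A \<in> sets borel" "uncountable A"
  shows "(UNIV :: real set) \<lesssim> A"
proof -
  obtain C :: "(nat \<Rightarrow> real) set" where C: "closed C" "bij_betw (\<lambda>x. x 0) C A"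
    using injective_projection_borel[OF assms(1)] unfolding injective_projection_def by blast
  then have "C \<approx> A"
    unfolding eqpoll_def by blast
  with assms(2) have "uncountable C"
    using countable_eqpoll eqpoll_sym by blast
  from uncountable_closed_lepoll_reals[OF C(1) this] \<open>C \<approx> A\<close> show ?thesis
    by (rule lepoll_trans2)
qed

lemma borel_sets_lepoll_reals: "sets (borel :: real measure) \<lesssim> (UNIV :: real set)"
proof -
  have "sets (borel :: real measure) \<subseteq> (\<lambda>C. (\<lambda>x. x 0) ` C) ` {C :: (nat \<Rightarrow> real) set. closed C}"
    using injective_projection_borel unfolding injective_projection_def bij_betw_def by blast
  then have "sets (borel :: real measure) \<lesssim> {C :: (nat \<Rightarrow> real) set. closed C}"
    by (rule subset_image_lepoll)
  then show ?thesis
    using closed_sets_lepoll_reals by (rule lepoll_trans)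
qed

section \<open>Selecting separated sets\<close>

text \<open>Recursion along a well-order with small segments: the sets chosen earlier rule out fewer
  than continuum many points, and \<open>avoid\<close> supplies a candidate missing all of
  them.\<close>

lemma separated_selection:
  fixes \<S> :: "real \<Rightarrow> real set set" and K :: "'a set"
  assumes K: "K \<prec> (UNIV :: real set)"
    and small: "\<And>i S. S \<in> \<S> i \<Longrightarrow> S \<lesssim> K"
    and avoid: "\<And>i D. D \<prec> (UNIV :: real set) \<Longrightarrow> \<exists>S \<in> \<S> i. S \<inter> D = {}"
  shows "\<exists>S. (\<forall>i. S i \<in> \<S> i) \<and>
    (\<forall>i j. i \<noteq> j \<longrightarrow> (\<forall>x \<in> S i. \<forall>y \<in> S j. x - y \<notin> {-1, 0, 1}))"
proof -
  obtain R :: "(real \<times> real) set" where R: "wf R" "\<And>x y. x \<noteq> y \<Longrightarrow> (x, y) \<in> R \<or> (y, x) \<in> R"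
    "\<And>x. {y. (y, x) \<in> R} \<prec> (UNIV :: real set)"
    by (rule ex_wf_small_segments[where ?'a = real]) (rule that; blast)
  define P where "P S i T \<longleftrightarrow>
    T \<in> \<S> i \<and> (\<forall>j x y. (j, i) \<in> R \<longrightarrow> x \<in> T \<longrightarrow> y \<in> S j \<longrightarrow> x - y \<notin> {-1, 0, 1})"
    for S :: "real \<Rightarrow> real set" and i T
  have "\<exists>S. \<forall>i. P S i (S i)"
  proof (rule dependent_wf_choice[OF R(1)])
    show "P S i T = P S' i T" if "\<And>j. (j, i) \<in> R \<Longrightarrow> S j = S' j" for S S' i T
      using that by (simp add: P_def)
  next
    fix i and S :: "real \<Rightarrow> real set"
    assume IH: "\<And>j. (j, i) \<in> R \<Longrightarrow> P S j (S j)"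
    \<comment> \<open>Enumerating every earlier set by \<open>K\<close> makes the forbidden set
      \<open>D\<close> an image of a product of three small sets. This bounds its size even if the
      continuum is singular.\<close>
    have "\<exists>g. S j \<subseteq> g ` K" if "(j, i) \<in> R" for j
      using small[of "S j" j] IH[OF that] by (auto simp: P_def lepoll_iff)
    then obtain g where g: "\<And>j. (j, i) \<in> R \<Longrightarrow> S j \<subseteq> g j ` K"
      by metis
    let ?J = "({j. (j, i) \<in> R} \<times> K) \<times> {-1, 0, 1 :: real}"
    define D where "D = (\<lambda>((j, k), e). g j k + e) ` ?J"
    have "?J \<prec> (UNIV :: real set)"
      by (intro lesspoll_Times R K finite_lesspoll_infinite) (simp_all add: infinite_UNIV_char_0)
    then have "D \<prec> (UNIV :: real set)"
      unfolding D_def by (rule lesspoll_trans1[OF image_lepoll])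
    then obtain T where T: "T \<in> \<S> i" "T \<inter> D = {}"
      using avoid by blast
    have "x - y \<notin> {-1, 0, 1}" if "(j, i) \<in> R" "x \<in> T" "y \<in> S j" for j x y
    proof
      assume *: "x - y \<in> {-1, 0, 1}"
      have "y \<in> g j ` K"
        using g that by blast
      then obtain k where "k \<in> K" "y = g j k"
        by blast
      then have "x \<in> D"
        unfolding D_def using that * by (intro image_eqI[of _ _ "((j, k), x - y)"]) auto
      with T that show False
        by blast
    qed
    with T show "\<exists>T. P S i T"
      unfolding P_def by blast
  qed
  then obtain S where S: "\<And>i. P S i (S i)"
    by blast
  have "x - y \<notin> {-1, 0, 1}" if "x \<in> S i" "y \<in> S j" "i \<noteq> j" for i j x y
  proof -
    have "(i, j) \<in> R \<or> (j, i) \<in> R"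
      using R(2) that by blast
    \<comment> \<open>The recursion compares a set only with its predecessors, but {-1, 0, 1} is
      symmetric, so the order of \<open>i\<close> and \<open>j\<close> is irrelevant.\<close>
    then have "x - y \<notin> {-1, 0, 1} \<or> y - x \<notin> {-1, 0, 1}"
      using S[of i] S[of j] that unfolding P_def by blast
    then show ?thesis
      by auto
  qed
  moreover have "S i \<in> \<S> i" for i
    using S unfolding P_def by blast
  ultimately show ?thesis
    by blast
qed

text \<open>A translation by \<open>t\<close> is bad only if \<open>t\<close> is a difference
  \<open>d - f\<close>, and there are fewer than continuum many of these.\<close>

lemma translate_avoiding:
  fixes D F :: "real set"
  assumes "D \<prec> (UNIV :: real set)" "F \<prec> (UNIV :: real set)"
  obtains t where "(\<lambda>f. f + t) ` F \<inter> D = {}"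
proof -
  have "D \<times> F \<prec> (UNIV :: real set)"
    using assms by (intro lesspoll_Times) (simp_all add: infinite_UNIV_char_0)
  then have "(\<lambda>(d, f). d - f) ` (D \<times> F) \<prec> (UNIV :: real set)"
    by (rule lesspoll_trans1[OF image_lepoll])
  then obtain t where t: "t \<notin> (\<lambda>(d, f). d - f) ` (D \<times> F)"
    by (metis UNIV_eq_I lesspoll_not_refl)
  have "(\<lambda>f. f + t) ` F \<inter> D = {}"
  proof (rule ccontr)
    assume "(\<lambda>f. f + t) ` F \<inter> D \<noteq> {}"
    then obtain f where "f \<in> F" "f + t \<in> D"
      by blast
    then have "t \<in> (\<lambda>(d, f). d - f) ` (D \<times> F)"
      by (intro image_eqI[of _ _ "(f + t, f)"]) auto
    with t show False
      by contradiction
  qed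
  then show thesis
    by (rule that)
qed

lemma lesspoll_avoidance:
  assumes "D \<prec> A"
  obtains x where "x \<in> A" "x \<notin> D"
proof -
  have "\<not> A \<subseteq> D"
    using assms subset_imp_lepoll lesspoll_trans1 lesspoll_not_refl by blast
  then show thesis
    using that by blast
qed

section \<open>Extending a proper colouring of the lines \<open>x + \<int>\<close>\<close>

lemma extend_proper_colouring:
  fixes K :: "'a set" and \<phi> :: "real \<Rightarrow> 'a"
  assumes K: "(UNIV :: bool set) \<prec> K"
    and \<phi>: "\<phi> ` E \<subseteq> K"
    and proper: "\<And>x. \<lbrakk>x \<in> E; x + 1 \<in> E\<rbrakk> \<Longrightarrow> \<phi> x \<noteq> \<phi> (x + 1)"
  shows "\<exists>f. range f \<subseteq> K \<and> (\<forall>x \<in> E. f x = \<phi> x) \<and> (\<forall>x. f x \<noteq> f (x + 1))"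
proof -
  obtain R :: "(real \<times> real) set" where R: "wf R" "\<And>x y. x \<noteq> y \<Longrightarrow> (x, y) \<in> R \<or> (y, x) \<in> R"
    "\<And>x. {y. (y, x) \<in> R} \<prec> (UNIV :: real set)"
    by (rule ex_wf_small_segments[where ?'a = real]) (rule that; blast)
  \<comment> \<open>A neighbour in \<open>E\<close> counts with its prescribed colour even if it
    comes later in \<open>R\<close>. For a later neighbour outside \<open>E\<close>,
    \<open>undefined\<close> is a dummy: it makes \<open>P\<close> depend only on earlier values of
    \<open>f\<close>, and still at most two colours are forbidden.\<close>
  define P where "P f x r \<longleftrightarrow> (if x \<in> E then r = \<phi> x else
      r \<in> K \<and> (\<forall>y \<in> {x - 1, x + 1}. r \<noteq> (if y \<in> E then \<phi> y else if (y, x) \<in> R then f y else undefined)))"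
    for f x r
  have "\<exists>f. \<forall>x. P f x (f x)"
  proof (rule dependent_wf_choice[OF R(1)])
    show "P f x r = P g x r" if "\<And>z. (z, x) \<in> R \<Longrightarrow> f z = g z" for f g x r
      using that by (simp add: P_def)
  next
    fix x f
    define c where "c y = (if y \<in> E then \<phi> y else if (y, x) \<in> R then f y else undefined)" for y
    have "{c (x - 1), c (x + 1)} \<subseteq> (\<lambda>b. if b then c (x - 1) else c (x + 1)) ` UNIV"
      by (auto simp: image_iff)
    then have "{c (x - 1), c (x + 1)} \<lesssim> (UNIV :: bool set)"
      by (rule subset_image_lepoll)
    then have "{c (x - 1), c (x + 1)} \<prec> K"
      using K by (rule lesspoll_trans1)
    then obtain r where "r \<in> K" "r \<notin> {c (x - 1), c (x + 1)}"
      by (rule lesspoll_avoidance)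
    then have "P f x (if x \<in> E then \<phi> x else r)"
      by (simp add: P_def c_def)
    then show "\<exists>r. P f x r"
      by blast
  qed
  then obtain f where f: "\<And>x. P f x (f x)"
    by blast
  have fE: "f x = \<phi> x" if "x \<in> E" for x
    using f[of x] that by (simp add: P_def)
  have "f x \<in> K" for x
    using f[of x] \<phi> by (cases "x \<in> E") (auto simp: P_def)
  moreover have "f x \<noteq> f (x + 1)" for x
  proof -
    \<comment> \<open>If neither point is in \<open>E\<close>, the later one avoided the colour of
      the earlier. If just one is in \<open>E\<close>, the other avoided its prescribed
      colour.\<close>
    have "(x, x + 1) \<in> R \<or> (x + 1, x) \<in> R"
      using R(2)[of x "x + 1"] by simp
    then show ?thesis
      using f[of x] f[of "x + 1"] proper[of x] fE[of x] fE[of "x + 1"]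
      by (cases "x \<in> E"; cases "x + 1 \<in> E") (auto simp: P_def)
  qed
  ultimately show ?thesis
    using fE by (intro exI[of _ f]) auto
qed

section \<open>The colouring that settles all tasks, and the resulting partition\<close>

lemma ex_colouring:
  fixes K :: "'a set"
  assumes K2: "(UNIV :: bool set) \<prec> K"
    and K: "K \<prec> (UNIV :: real set)"
    and PowK: "Pow K \<lesssim> (UNIV :: real set)"
  shows "\<exists>f :: real \<Rightarrow> 'a. range f \<subseteq> K \<and> (\<forall>x. f x \<noteq> f (x + 1)) \<and>
    (\<forall>Z \<in> sets borel. uncountable Z \<longrightarrow> (\<forall>\<xi> \<in> K. \<exists>x \<in> Z. f x = \<xi>)) \<and>
    (\<forall>F. F \<approx> K \<longrightarrow> (\<exists>t. bij_betw f ((\<lambda>x. x + t) ` F) K))"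
proof -
  define \<B> where "\<B> = {Z :: real set. Z \<in> sets borel \<and> uncountable Z}"
  define \<F> where "\<F> = {F :: real set. F \<approx> K}"
  have K0: "K \<noteq> {}"
    using K2 not_lesspoll_empty by blast
  have "\<B> \<lesssim> (UNIV :: real set)"
    using borel_sets_lepoll_reals subset_imp_lepoll[of \<B> "sets borel"] lepoll_trans
    by (auto simp: \<B>_def)
  then have "\<B> \<times> K \<lesssim> (UNIV :: real set) \<times> (UNIV :: real set)"
    by (intro times_lepoll_mono lesspoll_imp_lepoll[OF K])
  also have "(UNIV :: real set) \<times> (UNIV :: real set) \<approx> (UNIV :: real set)"
    by (rule infinite_square_eqpoll) (simp add: infinite_UNIV_char_0)
  finally have BK: "\<B> \<times> K \<lesssim> (UNIV :: real set)" .
  \<comment> \<open>The left summand lists the tasks of giving a Borel set a point of a given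
    colour, the right one the tasks of translating \<open>F\<close>. Bounding their number by the
    continuum yields the enumeration \<tau> by reals.\<close>
  have "\<B> \<times> K <+> \<F> \<lesssim> (UNIV :: real set) <+> (UNIV :: real set)"
    using BK image_size_subsets_lepoll_reals[OF PowK]
    unfolding \<F>_def by (rule sum_lepoll_mono)
  also have "(UNIV :: real set) <+> (UNIV :: real set) \<lesssim> (UNIV :: bool set) \<times> (UNIV :: real set)"
  proof (rule subset_image_lepoll, rule subsetI)
    fix z :: "real + real"
    show "z \<in> (\<lambda>(b, x). if b then Inl x else Inr x) ` (UNIV \<times> UNIV)"
      by (cases z) (auto simp: image_iff)
  qed
  also have "(UNIV :: bool set) \<times> (UNIV :: real set) \<lesssim> (UNIV :: real set) \<times> (UNIV :: real set)"
    by (intro times_lepoll_mono lesspoll_imp_lepoll[OF lesspoll_trans[OF K2 K]]) auto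
  also have "(UNIV :: real set) \<times> (UNIV :: real set) \<approx> (UNIV :: real set)"
    by (rule infinite_square_eqpoll) (simp add: infinite_UNIV_char_0)
  finally obtain \<tau> :: "real \<Rightarrow> (real set \<times> 'a) + real set" where \<tau>: "\<B> \<times> K <+> \<F> \<subseteq> range \<tau>"
    unfolding lepoll_iff by blast
  \<comment> \<open>These are the sets that could settle task \<open>i\<close>. A value of \<tau>
    that is no genuine task gets only the empty set, which avoids everything.\<close>
  define \<S> where "\<S> i = (case \<tau> i of
      Inl (Z, \<xi>) \<Rightarrow> if (Z, \<xi>) \<in> \<B> \<times> K then {{x} |x. x \<in> Z} else {{}}
    | Inr F \<Rightarrow> if F \<in> \<F> then {(\<lambda>x. x + t) ` F |t. True} else {{}})" for i
  have small: "T \<lesssim> K" if "T \<in> \<S> i" for i T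
  proof -
    have "{x} \<lesssim> K" for x :: real
      using K0 by (intro subset_image_lepoll[of _ "\<lambda>_. x"]) auto
    moreover have "(\<lambda>x. x + t) ` F \<lesssim> K" if "F \<in> \<F>" for F t
      using that image_lepoll lepoll_trans2 unfolding \<F>_def by blast
    ultimately show ?thesis
      using that unfolding \<S>_def by (auto split: sum.splits prod.splits if_splits)
  qed
  have avoid: "\<exists>T \<in> \<S> i. T \<inter> D = {}" if D: "D \<prec> (UNIV :: real set)" for i D
  proof -
    have 1: "\<exists>T \<in> {{x} |x. x \<in> Z}. T \<inter> D = {}" if "Z \<in> \<B>" for Z
    proof -
      have "(UNIV :: real set) \<lesssim> Z"
        using that uncountable_borel_lepoll_reals by (simp add: \<B>_def)
      with D have "D \<prec> Z"
        by (rule lesspoll_trans2)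
      then obtain x where "x \<in> Z" "x \<notin> D"
        by (rule lesspoll_avoidance)
      then show ?thesis
        by blast
    qed
    have 2: "\<exists>T \<in> {(\<lambda>x. x + t) ` F |t. True}. T \<inter> D = {}" if "F \<in> \<F>" for F
    proof -
      have "F \<prec> (UNIV :: real set)"
        using that K eq_lesspoll_trans unfolding \<F>_def by blast
      with D obtain t where "(\<lambda>x. x + t) ` F \<inter> D = {}"
        by (rule translate_avoiding)
      then show ?thesis
        by blast
    qed
    show ?thesis
      using 1 2 by (auto simp: \<S>_def split: sum.splits prod.splits)
  qed
  have "\<exists>S. (\<forall>i. S i \<in> \<S> i) \<and>
      (\<forall>i j. i \<noteq> j \<longrightarrow> (\<forall>x \<in> S i. \<forall>y \<in> S j. x - y \<notin> {-1, 0, 1}))"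
    using K small avoid by (rule separated_selection)
  then obtain S where S_mem: "\<forall>i. S i \<in> \<S> i"
    and S_sep: "\<forall>i j. i \<noteq> j \<longrightarrow> (\<forall>x \<in> S i. \<forall>y \<in> S j. x - y \<notin> {-1, 0, 1})"
    by (elim exE conjE)
  have S: "S i \<in> \<S> i" "\<lbrakk>x \<in> S i; y \<in> S j; i \<noteq> j\<rbrakk> \<Longrightarrow> x - y \<notin> {-1, 0, 1}" for i j x y
    using S_mem S_sep by blast+
  define c where "c i = (case \<tau> i of Inl (Z, \<xi>) \<Rightarrow> (\<lambda>_. \<xi>) | Inr F \<Rightarrow> (SOME h. bij_betw h (S i) K))" for i
  have c_bij: "bij_betw (c i) (S i) K" if i: "\<tau> i = Inr F" and F: "F \<in> \<F>" for i F
  proof -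
    obtain t where t: "S i = (\<lambda>x. x + t) ` F"
      using S(1)[of i] i F by (auto simp: \<S>_def)
    have "S i \<approx> F"
      unfolding t by (intro inj_on_image_eqpoll_self inj_onI) simp
    then have "S i \<approx> K"
      using F eqpoll_trans unfolding \<F>_def by blast
    then show ?thesis
      using i someI_ex[of "\<lambda>h. bij_betw h (S i) K"] by (simp add: eqpoll_def c_def)
  qed
  \<comment> \<open>Injectivity on each \<open>S i\<close>, a singleton, a bijectively coloured
    translate or empty, will separate points at distance 1 inside the same \<open>S i\<close>, since
    \<open>F\<close> itself may contain such points.\<close>
  have c_K: "c i x \<in> K" and c_inj: "\<lbrakk>c i x = c i y; y \<in> S i\<rbrakk> \<Longrightarrow> x = y" if "x \<in> S i" for i x y
  proof -
    show "c i x \<in> K"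
    proof (cases "\<tau> i")
      case (Inl p)
      then show ?thesis
        using S(1)[of i] that by (cases p) (auto simp: \<S>_def c_def split: if_splits)
    next
      case (Inr F)
      then have "F \<in> \<F>"
        using S(1)[of i] that by (auto simp: \<S>_def split: if_splits)
      then show ?thesis
        using c_bij[OF Inr] that bij_betwE by blast
    qed
    show "x = y" if "c i x = c i y" "y \<in> S i"
    proof (cases "\<tau> i")
      case (Inl p)
      then show ?thesis
        using S(1)[of i] that \<open>x \<in> S i\<close> by (cases p) (auto simp: \<S>_def split: if_splits)
    next
      case (Inr F)
      then have "F \<in> \<F>"
        using S(1)[of i] that by (auto simp: \<S>_def split: if_splits)
      then show ?thesis
        using c_bij[OF Inr] that \<open>x \<in> S i\<close> by (meson bij_betw_imp_inj_on inj_onD)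
    qed
  qed
  \<comment> \<open>The index is unique because the exclusion of difference 0 makes distinct
    \<open>S i\<close> disjoint.\<close>
  define \<phi> where "\<phi> x = c (THE i. x \<in> S i) x" for x
  have \<phi>: "\<phi> x = c i x" if "x \<in> S i" for i x
  proof -
    have "(THE i. x \<in> S i) = i"
      using that S(2)[OF that, of x] by (intro the_equality) auto
    then show ?thesis
      by (simp add: \<phi>_def)
  qed
  define E where "E = (\<Union>i. S i)"
  have "\<phi> ` E \<subseteq> K"
    using c_K by (auto simp: E_def \<phi>)
  moreover have "\<phi> x \<noteq> \<phi> (x + 1)" if x: "x \<in> E" "x + 1 \<in> E" for x
  proof -
    obtain i j where ij: "x \<in> S i" "x + 1 \<in> S j"
      using x by (auto simp: E_def)
    \<comment> \<open>Points at distance 1 cannot lie in different selected sets, so only the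
      injectivity of \<open>c i\<close> is left to use.\<close>
    then have [simp]: "j = i"
      using S(2)[OF ij] by auto
    show ?thesis
      using c_inj[OF ij(1), of "x + 1"] ij by (auto simp: \<phi>)
  qed
  ultimately have "\<exists>f. range f \<subseteq> K \<and> (\<forall>x \<in> E. f x = \<phi> x) \<and> (\<forall>x. f x \<noteq> f (x + 1))"
    by (rule extend_proper_colouring[OF K2])
  then obtain f where f: "range f \<subseteq> K" "\<forall>x \<in> E. f x = \<phi> x" "\<forall>x. f x \<noteq> f (x + 1)"
    by (elim exE conjE)
  have f_eq: "f x = c i x" if "x \<in> S i" for i x
    using that f(2) by (auto simp: E_def \<phi>)
  show ?thesis
  proof (intro exI[of _ f] conjI ballI allI impI)
    show "\<exists>x \<in> Z. f x = \<xi>" if "Z \<in> sets borel" "uncountable Z" "\<xi> \<in> K" for Z and \<xi>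
    proof -
      have *: "(Z, \<xi>) \<in> \<B> \<times> K"
        using that by (simp add: \<B>_def)
      then have "Inl (Z, \<xi>) \<in> range \<tau>"
        by (intro subsetD[OF \<tau>] InlI)
      then obtain i where i: "\<tau> i = Inl (Z, \<xi>)"
        by (elim rangeE) simp
      then obtain x where "x \<in> Z" "x \<in> S i"
        using S(1)[of i] * by (auto simp: \<S>_def)
      then show ?thesis
        using f_eq[of x i] i by (auto simp: c_def)
    qed
    show "\<exists>t. bij_betw f ((\<lambda>x. x + t) ` F) K" if "F \<approx> K" for F
    proof -
      have F: "F \<in> \<F>"
        using that by (simp add: \<F>_def)
      then have "Inr F \<in> range \<tau>"
        by (intro subsetD[OF \<tau>] InrI)
      then obtain i where i: "\<tau> i = Inr F"
        by (elim rangeE) simp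
      then obtain t where t: "S i = (\<lambda>x. x + t) ` F"
        using S(1)[of i] F by (auto simp: \<S>_def)
      have "bij_betw f (S i) K"
        using c_bij[OF i F] f_eq by (subst bij_betw_cong) auto
      then show ?thesis
        unfolding t by blast
    qed
  qed (use f in auto)
qed

theorem mainTheorem10:
  fixes K :: "'a set"
  assumes "(UNIV :: bool set) \<prec> K"
    and "K \<prec> (UNIV :: real set)"
    and "Pow K \<lesssim> (UNIV :: real set)"
  shows "\<exists>B :: 'a \<Rightarrow> real set.
           (\<forall>\<xi>\<in>K. \<forall>\<eta>\<in>K. \<xi> \<noteq> \<eta> \<longrightarrow> B \<xi> \<inter> B \<eta> = {}) \<and>
           (\<Union>\<xi>\<in>K. B \<xi>) = UNIV \<and>
           (\<forall>\<xi>\<in>K. bernstein (B \<xi>)) \<and>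
           (\<forall>\<xi>\<in>K. \<not> two_covering (B \<xi>)) \<and>
           S_covering K (B ` K)"
proof -
  obtain f :: "real \<Rightarrow> 'a" where f: "range f \<subseteq> K" "\<forall>x. f x \<noteq> f (x + 1)"
    and f_borel: "\<forall>Z \<in> sets borel. uncountable Z \<longrightarrow> (\<forall>\<xi> \<in> K. \<exists>x \<in> Z. f x = \<xi>)"
    and f_bij: "\<forall>F. F \<approx> K \<longrightarrow> (\<exists>t. bij_betw f ((\<lambda>x. x + t) ` F) K)"
    using ex_colouring[OF assms] by (elim exE conjE)
  define B where "B \<xi> = {x. f x = \<xi>}" for \<xi>
  \<comment> \<open>A second colour provides the points of \<open>Z\<close> outside
    \<open>B \<xi>\<close> in the Bernstein property.\<close>
  have other: "\<exists>\<eta> \<in> K. \<eta> \<noteq> \<xi>" for \<xi>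
  proof -
    have "f 0 \<in> K" "f (0 + 1) \<in> K" "f 0 \<noteq> f (0 + 1)"
      using f by blast+
    then show ?thesis
      by metis
  qed
  have "bernstein (B \<xi>)" if "\<xi> \<in> K" for \<xi>
    unfolding bernstein_def
  proof (intro allI impI)
    fix Z :: "real set"
    assume Z: "Z \<in> sets borel \<and> uncountable Z"
    obtain \<eta> where "\<eta> \<in> K" "\<eta> \<noteq> \<xi>"
      using other by blast
    moreover have "\<exists>x \<in> Z. f x = \<zeta>" if "\<zeta> \<in> K" for \<zeta>
      using f_borel Z that by simp
    ultimately show "Z \<inter> B \<xi> \<noteq> {} \<and> Z - B \<xi> \<noteq> {}"
      using \<open>\<xi> \<in> K\<close> unfolding B_def by fastforce
  qed
  moreover have "\<not> two_covering (B \<xi>)" for \<xi>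
  proof
    assume "two_covering (B \<xi>)"
    moreover have "card {0, 1 :: real} = 2"
      by simp
    ultimately obtain x where "(\<lambda>c. c + x) ` {0, 1} \<subseteq> B \<xi>"
      unfolding two_covering_def by blast
    then have "f x = f (x + 1)"
      by (simp add: B_def add.commute)
    with f(2) show False
      by blast
  qed
  moreover have "S_covering K (B ` K)"
    unfolding S_covering_def
  proof (intro conjI allI impI ballI)
    show "A \<inter> A' = {}" if "A \<in> B ` K" "A' \<in> B ` K" "A \<noteq> A'" for A A'
      using that by (auto simp: B_def)
    \<comment> \<open>The real line is itself an uncountable Borel set, so every colour occurs.
      Disjoint nonempty classes are distinct, which gives the family the size of
      \<open>K\<close>.\<close>
    have "B \<xi> \<noteq> {}" if "\<xi> \<in> K" for \<xi>
      using bspec[OF f_borel, of UNIV] that uncountable_UNIV_real by (auto simp: B_def)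
    then have "inj_on B K"
      by (intro inj_onI) (auto simp: B_def)
    then show "B ` K \<approx> K"
      by (rule inj_on_image_eqpoll_self)
    fix F :: "real set"
    assume "F \<approx> K"
    then obtain t where t: "bij_betw f ((\<lambda>x. x + t) ` F) K"
      using f_bij by blast
    have "card ((\<lambda>x. x + t) ` F \<inter> B \<xi>) = 1" if "\<xi> \<in> K" for \<xi>
    proof -
      have "\<xi> \<in> f ` (\<lambda>x. x + t) ` F"
        using bij_betw_imp_surj_on[OF t] that by simp
      then obtain x where x: "x \<in> (\<lambda>x. x + t) ` F" "f x = \<xi>"
        by (elim imageE[where f = f]) simp
      then have "(\<lambda>x. x + t) ` F \<inter> B \<xi> = {x}"
        using bij_betw_imp_inj_on[OF t] by (auto simp: B_def dest: inj_onD)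
      then show ?thesis
        by simp
    qed
    moreover have "(\<lambda>x. x + t) ` F \<subseteq> \<Union>(B ` K)"
      using f(1) by (auto simp: B_def)
    ultimately show "\<exists>t. (\<lambda>f. f + t) ` F \<subseteq> \<Union>(B ` K) \<and> (\<forall>A\<in>B ` K. card ((\<lambda>f. f + t) ` F \<inter> A) = 1)"
      by blast
  qed
  ultimately show ?thesis
    using f(1) by (intro exI[of _ B]) (auto simp: B_def)
qed

end
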